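(* Let $M^2$ be a meridian surface in $\mathbb{E}^4$ given by the parametrization $z(u,v)=f(u)\,r(v)+g(u)\,e_4$, $u\in I$, $v\in J$, with $g'=0$. Then $M^2$ has pointwise 1-type Gauss map of the second kind if and only if the curve $c: r=r(v)$ is a circle with non-zero constant spherical curvature and the meridian curve $\alpha: u\mapsto (f(u),g(u))$ is determined by $f(u)=\pm u+a$, $g(u)=b$, where $a=\mathrm{const}$, $b=\mathrm{const}$. In this case $M^2$ is a developable ruled surface lying in a 3-dimensional space.
   Context: Meridian surface: Let $\{e_1,e_2,e_3,e_4\}$ be the standard orthonormal frame in $\mathbb{E}^4$ and $S^2(1)$ the unit 2-sphere centered at the origin in $\mathbb{E}^3=\mathrm{span}\{e_1,e_2,e_3\}$. Let $c: r=r(v)$, $v\in J$, $J\subset\mathbb{R}$, be a smooth curve on $S^2(1)$ parametrized by arc length. Put $t=r'$ and let $\{t(v),n(v),r(v)\}$ be the orthonormal moving frame along $c$ in $\mathbb{E}^3$ with $r'=t$, $t'=\kappa n-r$, $n'=-\kappa t$; the function $\kappa(v)=\langle t'(v),n(v)\rangle$ is the spherical curvature of $c$. Let $f=f(u)$, $g=g(u)$ be non-zero smooth functions on an interval $I\subset\mathbb{R}$ with $f'(u)^2+g'(u)^2=1$ for all $u\in I$. The meridian surface $M^2$ is the surface $z(u,v)=f(u)\,r(v)+g(u)\,e_4$, $u\in I$, $v\in J$, with the induced metric $du^2+f(u)^2dv^2$. Gauss map: with $x=z_u$ and $y=z_v/f=t$, which form an orthonormal tangent frame, the Gauss map is $G=x\wedge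 y$, regarded as a map into the vector space $\wedge^2\mathbb{E}^4\cong\mathbb{E}^6$. Laplacian: $\Delta\phi=-\sum_i\left(\nabla'_{\epsilon_i}\nabla'_{\epsilon_i}\phi-\nabla'_{\nabla_{\epsilon_i}\epsilon_i}\phi\right)$ for a local orthonormal tangent frame $\{\epsilon_1,\epsilon_2\}$, where $\nabla$ is the Levi-Civita connection of $M^2$ and $\nabla'$ is the flat derivative of the ambient space; it is applied componentwise to vector-valued maps such as $G$. Pointwise 1-type Gauss map: $M^2$ has pointwise 1-type Gauss map if $\Delta G=\lambda(G+C)$ for some non-zero smooth function $\lambda$ on $M^2$ and some constant vector $C\in\wedge^2\mathbb{E}^4$. It is of the first kind if $C=0$ and of the second kind otherwise. A developable ruled surface is a ruled surface with zero Gauss curvature.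
   Formalization: Surfaces lying in a plane are excluded on the left of the equivalence: if c is a great circle then G is constant and the equation holds with C = -G, so the surface is of the second kind although the spherical curvature is zero. *)

theory Defs
  imports "HOL-Analysis.Analysis"
begin

text \<open>Smoothness on an open set, by iterated directional derivatives.\<close>

primrec C_k_on :: "nat \<Rightarrow> ('a::real_normed_vector \<Rightarrow> 'b::real_normed_vector) \<Rightarrow> 'a set \<Rightarrow> bool" where
  "C_k_on 0 f S \<longleftrightarrow> continuous_on S f"
| "C_k_on (Suc k) f S \<longleftrightarrow>
     (\<forall>x\<in>S. f differentiable (at x)) \<and>
     (\<forall>h. C_k_on k (\<lambda>x. frechet_derivative f (at x) h) S)"

definition smooth_on :: "('a::real_normed_vector \<Rightarrow> 'b::real_normed_vector) \<Rightarrow> 'a set \<Rightarrow> bool" where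
  "smooth_on f S \<longleftrightarrow> (\<forall>k. C_k_on k f S)"

definition open_interval :: "real set \<Rightarrow> bool" where
  "open_interval I \<longleftrightarrow> open I \<and> is_interval I \<and> I \<noteq> {}"


text \<open>
  A surface patch is a map \<open>z\<close> from an open subset of the \<open>(u, v)\<close>-plane \<^typ>\<open>real ^ 2\<close> to
  \<^typ>\<open>real ^ 4\<close>, with \<open>u = p $ 1\<close> and \<open>v = p $ 2\<close>.  A tangent vector field is given by its
  components with respect to the coordinate fields \<open>z\<^sub>u\<close> and \<open>z\<^sub>v\<close>, that is, as a map \<open>X\<close> from
  \<^typ>\<open>real ^ 2\<close> to \<^typ>\<open>real ^ 2\<close>.
\<close>

definition pd :: "2 \<Rightarrow> (real ^ 2 \<Rightarrow> 'b::real_normed_vector) \<Rightarrow> real ^ 2 \<Rightarrow> 'b" where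
  "pd i \<phi> p = vector_derivative (\<lambda>s. \<phi> (p + s *\<^sub>R axis i 1)) (at 0)"

text \<open>
  The flat derivative of \<open>\<phi>\<close> along \<open>X\<close>.  For \<open>\<phi> = z\<close> this is the field \<open>X\<close> itself, as a vector
  of the ambient space.
\<close>

definition flat_deriv ::
    "(real ^ 2 \<Rightarrow> real ^ 2) \<Rightarrow> (real ^ 2 \<Rightarrow> 'b::real_normed_vector) \<Rightarrow> real ^ 2 \<Rightarrow> 'b" where
  "flat_deriv X \<phi> p = (\<Sum>i\<in>UNIV. X p $ i *\<^sub>R pd i \<phi> p)"

definition first_form :: "(real ^ 2 \<Rightarrow> real ^ 4) \<Rightarrow> real ^ 2 \<Rightarrow> real ^ 2 ^ 2" where
  "first_form z p = (\<chi> i j. pd i z p \<bullet> pd j z p)"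

text \<open>Christoffel symbols of the induced metric; \<open>k\<close> is the upper index.\<close>

definition christoffel :: "(real ^ 2 \<Rightarrow> real ^ 4) \<Rightarrow> 2 \<Rightarrow> 2 \<Rightarrow> 2 \<Rightarrow> real ^ 2 \<Rightarrow> real" where
  "christoffel z k i j p =
     (\<Sum>l\<in>UNIV. matrix_inv (first_form z p) $ k $ l *
        (pd i (\<lambda>q. first_form z q $ j $ l) p + pd j (\<lambda>q. first_form z q $ i $ l) p
         - pd l (\<lambda>q. first_form z q $ i $ j) p)) / 2"

text \<open>The Levi-Civita connection of the induced metric: the covariant derivative of \<open>Y\<close> along \<open>X\<close>.\<close>

definition levi_civita ::
    "(real ^ 2 \<Rightarrow> real ^ 4) \<Rightarrow> (real ^ 2 \<Rightarrow> real ^ 2) \<Rightarrow> (real ^ 2 \<Rightarrow> real ^ 2) \<Rightarrow> real ^ 2 \<Rightarrow> real ^ 2" where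
  "levi_civita z X Y p =
     (\<chi> k. flat_deriv X (\<lambda>q. Y q $ k) p
          + (\<Sum>i\<in>UNIV. \<Sum>j\<in>UNIV. christoffel z k i j p * X p $ i * Y p $ j))"

text \<open>
  \<open>K = \<langle>R(\<partial>\<^sub>1, \<partial>\<^sub>2)\<partial>\<^sub>2, \<partial>\<^sub>1\<rangle> / det (g\<^sub>i\<^sub>j)\<close>; the bracket term of the curvature tensor vanishes for
  coordinate fields.
\<close>

definition gauss_curvature :: "(real ^ 2 \<Rightarrow> real ^ 4) \<Rightarrow> real ^ 2 \<Rightarrow> real" where
  "gauss_curvature z p =
     (let D = (\<lambda>i::2. \<lambda>q::real ^ 2. axis i 1 :: real ^ 2);
          R = (\<lambda>q. levi_civita z (D 1) (levi_civita z (D 2) (D 2)) q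
                   - levi_civita z (D 2) (levi_civita z (D 1) (D 2)) q)
      in (flat_deriv R z p \<bullet> flat_deriv (D 1) z p) / det (first_form z p))"

text \<open>The geometer's sign; \<open>\<epsilon>\<close> is meant to be an orthonormal tangent frame.\<close>

definition laplacian ::
    "(real ^ 2 \<Rightarrow> real ^ 4) \<Rightarrow> (2 \<Rightarrow> real ^ 2 \<Rightarrow> real ^ 2) \<Rightarrow> (real ^ 2 \<Rightarrow> 'b::real_normed_vector)
      \<Rightarrow> real ^ 2 \<Rightarrow> 'b" where
  "laplacian z \<epsilon> \<phi> p =
     - (\<Sum>i\<in>UNIV. flat_deriv (\<epsilon> i) (flat_deriv (\<epsilon> i) \<phi>) p
                  - flat_deriv (levi_civita z (\<epsilon> i) (\<epsilon> i)) \<phi> p)"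


text \<open>
  The six-dimensional space of bivectors of \<^typ>\<open>real ^ 4\<close> is realised as the space of
  skew-symmetric matrices.
\<close>

definition bivectors :: "(real ^ 4 ^ 4) set" where
  "bivectors = {A. transpose A = - A}"

definition wedge :: "real ^ 4 \<Rightarrow> real ^ 4 \<Rightarrow> real ^ 4 ^ 4" where
  "wedge x y = (\<chi> i j. x $ i * y $ j - x $ j * y $ i)"

definition gauss_map ::
    "(real ^ 2 \<Rightarrow> real ^ 4) \<Rightarrow> (2 \<Rightarrow> real ^ 2 \<Rightarrow> real ^ 2) \<Rightarrow> real ^ 2 \<Rightarrow> real ^ 4 ^ 4" where
  "gauss_map z \<epsilon> p = wedge (flat_deriv (\<epsilon> 1) z p) (flat_deriv (\<epsilon> 2) z p)"

definition pointwise_1type_with ::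
    "(real ^ 2) set \<Rightarrow> (real ^ 2 \<Rightarrow> real ^ 4) \<Rightarrow> (2 \<Rightarrow> real ^ 2 \<Rightarrow> real ^ 2) \<Rightarrow> real ^ 4 ^ 4 \<Rightarrow> bool" where
  "pointwise_1type_with D z \<epsilon> C \<longleftrightarrow>
     (\<exists>lam :: real ^ 2 \<Rightarrow> real. smooth_on lam D \<and> (\<forall>p\<in>D. lam p \<noteq> 0) \<and>
        (\<forall>p\<in>D. laplacian z \<epsilon> (gauss_map z \<epsilon>) p = lam p *\<^sub>R (gauss_map z \<epsilon> p + C)))"

definition pointwise_1type_second_kind ::
    "(real ^ 2) set \<Rightarrow> (real ^ 2 \<Rightarrow> real ^ 4) \<Rightarrow> (2 \<Rightarrow> real ^ 2 \<Rightarrow> real ^ 2) \<Rightarrow> bool" where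
  "pointwise_1type_second_kind D z \<epsilon> \<longleftrightarrow> (\<exists>C\<in>bivectors. C \<noteq> 0 \<and> pointwise_1type_with D z \<epsilon> C)"


definition E3 :: "(real ^ 4) set" where
  "E3 = span {axis 1 1, axis 2 1, axis 3 1}"

definition tangent :: "(real \<Rightarrow> real ^ 4) \<Rightarrow> real \<Rightarrow> real ^ 4" where
  "tangent r v = vector_derivative r (at v)"

text \<open>
  An arc-length curve \<open>r\<close> on the unit sphere of \<^const>\<open>E3\<close>, with moving frame \<open>{t, n, r}\<close>.  The
  Frenet equations follow; \<open>n\<close> is determined by \<open>r\<close> up to sign.
\<close>

definition spherical_curve :: "real set \<Rightarrow> (real \<Rightarrow> real ^ 4) \<Rightarrow> (real \<Rightarrow> real ^ 4) \<Rightarrow> bool" where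
  "spherical_curve J r n \<longleftrightarrow>
     open_interval J \<and> smooth_on r J \<and> smooth_on n J \<and>
     (\<forall>v\<in>J. r v \<in> E3 \<inter> sphere 0 1 \<and> norm (tangent r v) = 1 \<and>
        n v \<in> E3 \<and> norm (n v) = 1 \<and> n v \<bullet> tangent r v = 0 \<and> n v \<bullet> r v = 0)"

definition spherical_curvature :: "(real \<Rightarrow> real ^ 4) \<Rightarrow> (real \<Rightarrow> real ^ 4) \<Rightarrow> real \<Rightarrow> real" where
  "spherical_curvature r n v = vector_derivative (tangent r) (at v) \<bullet> n v"

definition meridian_curve :: "real set \<Rightarrow> (real \<Rightarrow> real) \<Rightarrow> (real \<Rightarrow> real) \<Rightarrow> bool" where
  "meridian_curve I f g \<longleftrightarrow>
     open_interval I \<and> smooth_on f I \<and> smooth_on g I \<and>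
     (\<forall>u\<in>I. f u \<noteq> 0 \<and> g u \<noteq> 0 \<and> (deriv f u)\<^sup>2 + (deriv g u)\<^sup>2 = 1)"

definition param_domain :: "real set \<Rightarrow> real set \<Rightarrow> (real ^ 2) set" where
  "param_domain I J = {p. p $ 1 \<in> I \<and> p $ 2 \<in> J}"

definition meridian_surface ::
    "(real \<Rightarrow> real) \<Rightarrow> (real \<Rightarrow> real) \<Rightarrow> (real \<Rightarrow> real ^ 4) \<Rightarrow> real ^ 2 \<Rightarrow> real ^ 4" where
  "meridian_surface f g r p = f (p $ 1) *\<^sub>R r (p $ 2) + g (p $ 1) *\<^sub>R axis 4 1"

text \<open>The orthonormal tangent frame \<open>x = z\<^sub>u\<close>, \<open>y = z\<^sub>v / f\<close>.\<close>

definition meridian_frame :: "(real \<Rightarrow> real) \<Rightarrow> 2 \<Rightarrow> real ^ 2 \<Rightarrow> real ^ 2" where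
  "meridian_frame f i p = (if i = 1 then axis 1 1 else (1 / f (p $ 1)) *\<^sub>R axis 2 1)"


definition circle :: "(real ^ 4) set \<Rightarrow> bool" where
  "circle S \<longleftrightarrow>
     (\<exists>P c \<rho>. affine P \<and> aff_dim P = 2 \<and> c \<in> P \<and> \<rho> > 0 \<and> S = P \<inter> sphere c \<rho>)"

definition lies_in_dim :: "int \<Rightarrow> (real ^ 4) set \<Rightarrow> bool" where
  "lies_in_dim d S \<longleftrightarrow> (\<exists>H. affine H \<and> aff_dim H = d \<and> S \<subseteq> H)"

text \<open>
  A surface swept out by a moving straight line: it has a regular parametrization
  \<open>(s, t) \<mapsto> \<beta>(t) + s w(t)\<close>.  Regularity is expressed by the wedge product of the two partial
  derivatives.
\<close>

definition ruled_surface :: "(real ^ 4) set \<Rightarrow> bool" where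
  "ruled_surface S \<longleftrightarrow>
     (\<exists>K L \<beta> w. open_interval K \<and> open_interval L \<and> smooth_on \<beta> L \<and> smooth_on w L \<and>
        (\<forall>s\<in>K. \<forall>t\<in>L.
           wedge (w t) (vector_derivative \<beta> (at t) + s *\<^sub>R vector_derivative w (at t)) \<noteq> 0) \<and>
        S = {\<beta> t + s *\<^sub>R w t | s t. s \<in> K \<and> t \<in> L})"

definition developable_ruled :: "(real ^ 2) set \<Rightarrow> (real ^ 2 \<Rightarrow> real ^ 4) \<Rightarrow> bool" where
  "developable_ruled D z \<longleftrightarrow> ruled_surface (z ` D) \<and> (\<forall>p\<in>D. gauss_curvature z p = 0)"

end

theory Submission
  imports Defs
begin

text \<open>
  If \<open>g\<close> is constant, then \<open>f u = \<sigma> u + a\<close> with \<open>\<sigma> = 1\<close> or \<open>\<sigma> = -1\<close>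
  (\<open>meridian_curve_constant_g\<close>), and the meridian surface is a cone over the spherical curve \<open>r\<close>.
  A cone is flat, is ruled by its generating lines and lies in the hyperplane \<open>x\<^sub>4 = b\<close>.  This
  settles the condition on the meridian and the final claim.

  The Gauss map of the cone is \<open>G = \<sigma> r \<and> t\<close>, which depends on \<open>v\<close> only, so its Laplacian is
  \<open>- G'' / f\<^sup>2\<close> (\<open>laplacian_gauss_map\<close>).  By the Frenet equations the Laplacian equation becomes an
  ordinary differential equation along the curve for the three coordinates of a constant bivector
  in the moving frame.  It has a solution if and only if the spherical curvature is constant
  (\<open>curvature_constant_if_second_kind\<close>, \<open>second_kind_if_curvature_constant\<close>).

  The constant is zero exactly when the curve runs on a great circle and the cone is a piece of a
  plane (\<open>lies_in_plane_if_curvature_zero\<close>, \<open>curvature_zero_if_lies_in_plane\<close>).  The Gauss map of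
  a plane is itself constant and satisfies the equation with \<open>C = - G\<close>, which is why planes have
  to be excluded on the left of the equivalence.  A curve of constant curvature on the sphere lies
  on a circle (\<open>const_curvature_circle\<close>).
\<close>

section \<open>Smooth maps\<close>

lemma C_k_on_cong:
  assumes "open S" "\<And>x. x \<in> S \<Longrightarrow> f x = g x" "C_k_on k f S"
  shows "C_k_on k g S"
  using assms(2,3)
proof (induction k arbitrary: f g)
  case 0
  then show ?case by (simp cong: continuous_on_cong)
next
  case (Suc k)
  have der: "(g has_derivative frechet_derivative f (at x)) (at x)" if "x \<in> S" for x
  proof (rule has_derivative_transform_within_open[OF _ \<open>open S\<close> that])
    show "(f has_derivative frechet_derivative f (at x)) (at x)"
      using Suc.prems(2) that by (simp add: frechet_derivative_works)
  qed (use Suc.prems(1) in auto)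
  have "frechet_derivative f (at x) = frechet_derivative g (at x)" if "x \<in> S" for x
    using frechet_derivative_at[OF der[OF that]] .
  then have "C_k_on k (\<lambda>x. frechet_derivative g (at x) h) S" for h
    by (rule Suc.IH[OF arg_cong[where f = "\<lambda>F. F h"]]) (use Suc.prems(2) in simp_all)
  then show ?case
    using der by (auto simp: differentiable_def)
qed

lemma smooth_on_has_vector_derivative:
  fixes h :: "real \<Rightarrow> 'b::real_normed_vector"
  assumes "smooth_on h S" "x \<in> S"
  shows "(h has_vector_derivative vector_derivative h (at x)) (at x)"
proof -
  have "C_k_on (Suc 0) h S" using assms(1) unfolding smooth_on_def by blast
  then show ?thesis using assms(2) by (simp add: vector_derivative_works)
qed

lemma smooth_on_vector_derivative:
  fixes h :: "real \<Rightarrow> 'b::real_normed_vector"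
  assumes "smooth_on h S" "open S"
  shows "smooth_on (\<lambda>x. vector_derivative h (at x)) S"
  unfolding smooth_on_def
proof
  fix k
  have "C_k_on (Suc k) h S" using assms(1) unfolding smooth_on_def by blast
  then have C: "C_k_on k (\<lambda>x. frechet_derivative h (at x) 1) S" by simp
  have "frechet_derivative h (at x) 1 = vector_derivative h (at x)" if "x \<in> S" for x
    using fun_cong[OF frechet_derivative_at[OF smooth_on_has_vector_derivative[OF assms(1) that,
      unfolded has_vector_derivative_def]], of 1] by simp
  then show "C_k_on k (\<lambda>x. vector_derivative h (at x)) S"
    by (rule C_k_on_cong[OF assms(2) _ C])
qed

lemma smooth_on_continuous_on:
  assumes "smooth_on h S"
  shows "continuous_on S h"
  using assms[unfolded smooth_on_def, rule_format, of 0] by simp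

lemma smooth_on_const: "smooth_on (\<lambda>x. c) S"
proof -
  have "C_k_on k (\<lambda>x. c) S" for k
    by (induction k arbitrary: c) (simp_all add: frechet_derivative_const)
  then show ?thesis by (simp add: smooth_on_def)
qed

text \<open>
  Proves that the proportionality factor of the Laplacian equation is smooth.  The coefficient and
  the exponent are arbitrary because the class of these functions must be closed under
  differentiation for the induction on the order to go through.
\<close>

lemma smooth_on_inverse_power_affine:
  fixes S :: "(real ^ 2) set"
  assumes "open S" "\<And>p. p \<in> S \<Longrightarrow> s * p $ 1 + a \<noteq> 0"
  shows "smooth_on (\<lambda>p. K * inverse (s * p $ 1 + a) ^ m) S"
proof -
  have "C_k_on k (\<lambda>p. K * inverse (s * p $ 1 + a) ^ m) S" for k
  proof (induction k arbitrary: K m)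
    case 0
    show ?case using assms(2) by (auto intro!: continuous_intros)
  next
    case (Suc k)
    have der: "((\<lambda>p. K * inverse (s * p $ 1 + a) ^ m) has_derivative
        (\<lambda>h. (- K * of_nat m * s * h $ 1) * inverse (s * p $ 1 + a) ^ (Suc m))) (at p)"
      if "p \<in> S" for p
    proof (cases m)
      case 0
      then show ?thesis by simp
    next
      case (Suc m')
      define Q where "Q = inverse (s * p $ 1 + a)"
      have "((\<lambda>p. p $ 1) has_derivative (\<lambda>h. h $ 1)) (at p)"
        by (intro bounded_linear_imp_has_derivative bounded_linear_vec_nth)
      then have "((\<lambda>p. inverse (s * p $ 1 + a)) has_derivative (\<lambda>h. - (Q * (s * h $ 1) * Q))) (at p)"
        unfolding Q_def using assms(2)[OF that] by (auto intro!: derivative_eq_intros)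
      from has_derivative_mult_right[OF has_derivative_power[OF this, of "Suc m'"], of K]
      show ?thesis unfolding Suc Q_def[symmetric] by (simp add: algebra_simps)
    qed
    have "C_k_on k (\<lambda>p. frechet_derivative (\<lambda>p. K * inverse (s * p $ 1 + a) ^ m) (at p) h) S" for h
      by (rule C_k_on_cong[OF assms(1) _ Suc.IH[of "- K * of_nat m * s * h $ 1" "Suc m"]])
        (use fun_cong[OF frechet_derivative_at[OF der]] in simp)
    then show ?case using der by (auto simp: differentiable_def)
  qed
  then show ?thesis by (simp add: smooth_on_def)
qed


section \<open>Derivatives that vanish\<close>

lemma has_vector_derivative_eq_on_open:
  assumes "(f has_vector_derivative a) (at x)" "(g has_vector_derivative b) (at x)"
    and "open S" "x \<in> S" "\<And>y. y \<in> S \<Longrightarrow> f y = g y"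
  shows "a = b"
  using has_vector_derivative_transform_within_open[OF assms(1,3,4,5)] assms(2)
  by (rule vector_derivative_unique_at)

lemma zero_derivative_imp_constant:
  assumes "convex S" "\<And>x. x \<in> S \<Longrightarrow> (f has_vector_derivative 0) (at x)"
  shows "\<exists>c. \<forall>x\<in>S. f x = c"
  by (rule has_vector_derivative_zero_constant[OF assms(1), of f])
    (use assms(2) in \<open>auto intro: has_vector_derivative_at_within\<close>)


section \<open>Bivectors as alternating forms\<close>

text \<open>
  The value of a skew-symmetric matrix as an alternating form.  On an orthonormal pair it is the
  coordinate of the bivector along the wedge of that pair, so evaluating both sides of a bivector
  equation on pairs of frame vectors compares coefficients.
\<close>

definition form :: "real ^ 4 ^ 4 \<Rightarrow> real ^ 4 \<Rightarrow> real ^ 4 \<Rightarrow> real" where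
  "form A x y = x \<bullet> (A *v y)"

lemma bounded_bilinear_wedge: "bounded_bilinear wedge"
proof -
  have "bilinear wedge"
    unfolding bilinear_def wedge_def
    by (auto intro!: linearI simp: vec_eq_iff algebra_simps)
  then show ?thesis by (simp add: bilinear_conv_bounded_bilinear)
qed

lemma bounded_bilinear_form: "bounded_bilinear (form A)"
proof -
  have "bilinear (form A)"
    unfolding bilinear_def form_def
    by (auto intro!: linearI simp: inner_add_left matrix_vector_right_distrib inner_add_right
       matrix_vector_mult_scaleR)
  then show ?thesis by (simp add: bilinear_conv_bounded_bilinear)
qed

lemma form_add: "form (A + B) x y = form A x y + form B x y"
  by (simp add: form_def matrix_vector_mult_add_rdistrib inner_add_right)

lemma form_scaleR: "form (c *\<^sub>R A) x y = c * form A x y"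
  by (simp add: form_def scaleR_matrix_vector_assoc[symmetric])

lemma form_diff: "form (A - B) x y = form A x y - form B x y"
  using form_add[of "A - B" B x y] by simp

lemma form_zero: "form 0 x y = 0"
  by (simp add: form_def)

lemma form_wedge: "form (wedge a b) x y = (x \<bullet> a) * (b \<bullet> y) - (x \<bullet> b) * (a \<bullet> y)"
proof -
  have "wedge a b *v y = (b \<bullet> y) *\<^sub>R a - (a \<bullet> y) *\<^sub>R b"
    by (simp add: wedge_def vec_eq_iff matrix_vector_mult_def inner_vec_def algebra_simps
       sum_subtractf sum_distrib_left)
  then show ?thesis by (simp add: form_def inner_diff_right)
qed

lemma form_skew:
  assumes "A \<in> bivectors"
  shows "form A x y = - form A y x"
proof -
  have "form A x y = (transpose A *v x) \<bullet> y"
    by (simp add: form_def dot_lmul_matrix)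
  also have "\<dots> = - form A y x"
  proof -
    have "transpose A = (- 1) *\<^sub>R A" using assms by (simp add: bivectors_def)
    then have "transpose A *v x = - (A *v x)"
      by (simp only: scaleR_matrix_vector_assoc[symmetric]) simp
    then show ?thesis by (simp add: form_def inner_commute)
  qed
  finally show ?thesis .
qed

lemma form_self:
  assumes "A \<in> bivectors"
  shows "form A x x = 0"
  using form_skew[OF assms, of x x] by simp

lemma wedge_anti: "wedge a b = - wedge b a"
  by (simp add: wedge_def vec_eq_iff)

lemma wedge_self: "wedge a a = 0"
  by (simp add: wedge_def vec_eq_iff)

lemma scaleR_wedge_in_bivectors: "c *\<^sub>R wedge a b \<in> bivectors"
  by (simp add: bivectors_def wedge_def transpose_def vec_eq_iff algebra_simps)

lemmas wedge_scaleR_left = bounded_bilinear.scaleR_left[OF bounded_bilinear_wedge]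
lemmas wedge_scaleR_right = bounded_bilinear.scaleR_right[OF bounded_bilinear_wedge]
lemmas wedge_diff_left = bounded_bilinear.diff_left[OF bounded_bilinear_wedge]
lemmas wedge_diff_right = bounded_bilinear.diff_right[OF bounded_bilinear_wedge]
lemmas wedge_minus_right = bounded_bilinear.minus_right[OF bounded_bilinear_wedge]
lemmas form_simps =
  bounded_bilinear.minus_left[OF bounded_bilinear_form]
  bounded_bilinear.minus_right[OF bounded_bilinear_form]
  bounded_bilinear.scaleR_left[OF bounded_bilinear_form]
  bounded_bilinear.scaleR_right[OF bounded_bilinear_form]
  bounded_bilinear.add_left[OF bounded_bilinear_form]
  bounded_bilinear.add_right[OF bounded_bilinear_form]
  bounded_bilinear.diff_left[OF bounded_bilinear_form]
  bounded_bilinear.diff_right[OF bounded_bilinear_form]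

section \<open>Frenet equations of a spherical curve\<close>

lemma in_E3_iff: "x \<in> E3 \<longleftrightarrow> x $ 4 = 0"
proof
  assume "x \<in> E3"
  then show "x $ 4 = 0" unfolding E3_def
    by (induction rule: span_induct_alt) (auto simp: axis_def)
next
  assume x: "x $ 4 = 0"
  have "x = x $ 1 *\<^sub>R axis 1 1 + x $ 2 *\<^sub>R axis 2 1 + x $ 3 *\<^sub>R axis 3 1"
    using x by (simp add: vec_eq_iff forall_4 axis_def)
  also have "\<dots> \<in> E3" unfolding E3_def
    by (intro span_add span_scale span_base) auto
  finally show "x \<in> E3" .
qed

text \<open>
  The three vectors and the fourth axis form an orthonormal basis of \<^typ>\<open>real ^ 4\<close>, and the
  difference of the two sides is orthogonal to all of it.
\<close>

lemma E3_orthonormal_expansion: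
  assumes "a \<in> E3" "b \<in> E3" "c \<in> E3" "x \<in> E3"
    and "a \<bullet> a = 1" "b \<bullet> b = 1" "c \<bullet> c = 1" "a \<bullet> b = 0" "a \<bullet> c = 0" "b \<bullet> c = 0"
  shows "x = (x \<bullet> a) *\<^sub>R a + (x \<bullet> b) *\<^sub>R b + (x \<bullet> c) *\<^sub>R c"
proof -
  define B where "B = {a, b, c, axis 4 1 :: real ^ 4}"
  have e: "a \<bullet> axis 4 1 = 0" "b \<bullet> axis 4 1 = 0" "c \<bullet> axis 4 1 = 0" "x \<bullet> axis 4 1 = 0"
    using assms(1-4) by (auto simp: in_E3_iff inner_axis)
  have e1: "axis 4 1 \<bullet> (axis 4 1 :: real ^ 4) = 1" by (simp add: inner_axis_axis)
  have dist: "a \<noteq> b" "a \<noteq> c" "b \<noteq> c" "a \<noteq> axis 4 1" "b \<noteq> axis 4 1" "c \<noteq> axis 4 1"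
    using assms e e1 by auto
  have "pairwise orthogonal B" unfolding B_def
    using assms e by (auto simp: pairwise_insert orthogonal_def inner_commute)
  moreover have "0 \<notin> B" using assms e1 unfolding B_def by auto
  ultimately have ind: "independent B" by (rule pairwise_orthogonal_independent)
  have "card B = 4" using dist by (simp add: B_def)
  then have "UNIV \<subseteq> span B"
    by (intro card_ge_dim_independent[OF _ ind]) auto
  moreover define y where "y = x - ((x \<bullet> a) *\<^sub>R a + (x \<bullet> b) *\<^sub>R b + (x \<bullet> c) *\<^sub>R c)"
  ultimately have "y \<in> span B" by auto
  moreover have "orthogonal y z" if "z \<in> B" for z
    using that assms e unfolding B_def y_def orthogonal_def
    by (auto simp: inner_diff_left inner_add_left inner_commute[of b a] inner_commute[of c a]
        inner_commute[of c b])
  ultimately have "orthogonal y y" by (blast intro: orthogonal_to_span)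
  then show ?thesis by (simp add: orthogonal_self y_def algebra_simps)
qed

lemmas has_vector_derivative_inner =
  bounded_bilinear.has_vector_derivative[OF bounded_bilinear_inner]
lemmas has_vector_derivative_wedge =
  bounded_bilinear.has_vector_derivative[OF bounded_bilinear_wedge]
lemmas has_vector_derivative_form =
  bounded_bilinear.has_vector_derivative[OF bounded_bilinear_form]

text \<open>
  Both planes of the proof arise in this way: the one that carries a spherical curve of constant
  curvature and the one that carries the cone over a great circle.
\<close>

lemma aff_dim_affine_slice:
  assumes "w \<in> E3" "w \<noteq> 0" "x0 $ 4 = h" "w \<bullet> x0 = d"
  shows "affine ({x. axis 4 1 \<bullet> x = h} \<inter> {x. w \<bullet> x = d})"
    "aff_dim ({x. axis 4 1 \<bullet> x = h} \<inter> {x. w \<bullet> x = d}) = 2"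
proof -
  let ?S = "{x. axis 4 1 \<bullet> x = h} :: (real ^ 4) set"
  have S: "x0 \<in> ?S" "x0 + w \<in> ?S"
    using assms(1,3) by (simp_all add: in_E3_iff inner_axis' )
  have "aff_dim ?S = 3"
    by (subst aff_dim_hyperplane) (simp_all add: axis_eq_0_iff)
  moreover have "x0 \<in> ?S \<inter> {x. w \<bullet> x = d}" using S(1) assms(4) by simp
  moreover have "w \<bullet> (x0 + w) \<noteq> d" using assms(2,4) by (simp add: inner_add_right)
  then have "\<not> ?S \<subseteq> {x. w \<bullet> x = d}" using S(2) by blast
  ultimately show "aff_dim (?S \<inter> {x. w \<bullet> x = d}) = 2"
    using aff_dim_affine_Int_hyperplane[OF affine_hyperplane, of "axis 4 1" h w d] by auto
  show "affine (?S \<inter> {x. w \<bullet> x = d})"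
    by (intro affine_Int affine_hyperplane)
qed

locale unit_spherical_curve =
  fixes J :: "real set" and r n :: "real \<Rightarrow> real ^ 4"
  assumes curve: "spherical_curve J r n"
begin

abbreviation "t \<equiv> tangent r"
abbreviation "\<kappa> \<equiv> spherical_curvature r n"

lemma J_open: "open J" and J_convex: "convex J" and J_nonempty: "J \<noteq> {}"
  using curve unfolding spherical_curve_def open_interval_def by (auto simp: is_interval_convex)

lemma smooth_t: "smooth_on t J"
  using curve J_open unfolding spherical_curve_def tangent_def
  by (blast intro: smooth_on_vector_derivative)

lemma deriv_r: "v \<in> J \<Longrightarrow> (r has_vector_derivative t v) (at v)"
  using curve unfolding spherical_curve_def tangent_def
  by (blast intro: smooth_on_has_vector_derivative)

lemma frame_in_E3: "r v \<in> E3" "t v \<in> E3" "n v \<in> E3" if "v \<in> J"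
proof -
  have r4: "r x $ 4 = 0" and n4: "n x $ 4 = 0" if "x \<in> J" for x
    using curve that unfolding spherical_curve_def by (auto simp: in_E3_iff)
  have "((\<lambda>x. r x $ 4) has_vector_derivative t v $ 4) (at v)"
    by (rule bounded_linear.has_vector_derivative[OF bounded_linear_vec_nth deriv_r[OF that]])
  from has_vector_derivative_eq_on_open[OF this has_vector_derivative_const J_open that r4]
  show "r v \<in> E3" "t v \<in> E3" "n v \<in> E3" using r4 n4 that by (auto simp: in_E3_iff)
qed

lemma frame_orthonormal:
  assumes "v \<in> J"
  shows "r v \<bullet> r v = 1" "t v \<bullet> t v = 1" "n v \<bullet> n v = 1"
    "r v \<bullet> t v = 0" "t v \<bullet> r v = 0" "r v \<bullet> n v = 0" "n v \<bullet> r v = 0" "t v \<bullet> n v = 0" "n v \<bullet> t v = 0"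
proof -
  have rr: "r x \<bullet> r x = 1" if "x \<in> J" for x
    using curve that unfolding spherical_curve_def by (auto simp: dot_square_norm)
  show "r v \<bullet> r v = 1" "t v \<bullet> t v = 1" "n v \<bullet> n v = 1"
    "r v \<bullet> n v = 0" "n v \<bullet> r v = 0" "t v \<bullet> n v = 0" "n v \<bullet> t v = 0"
    using rr curve assms unfolding spherical_curve_def by (auto simp: dot_square_norm inner_commute)
  from has_vector_derivative_eq_on_open[OF
      has_vector_derivative_inner[OF deriv_r deriv_r, OF assms assms]
      has_vector_derivative_const J_open assms rr]
  show "r v \<bullet> t v = 0" "t v \<bullet> r v = 0" by (auto simp: inner_commute)
qed

text \<open>
  The components of \<open>t'\<close> and \<open>n'\<close> along the frame come from differentiating the orthonormality
  relations; there is no fourth component because \<open>t\<close> and \<open>n\<close> stay in \<^const>\<open>E3\<close>.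
\<close>

lemma deriv_t: "(t has_vector_derivative \<kappa> v *\<^sub>R n v - r v) (at v)"
  and deriv_n: "(n has_vector_derivative - \<kappa> v *\<^sub>R t v) (at v)"
  and spherical_curvature_differentiable: "\<exists>k. (\<kappa> has_vector_derivative k) (at v)"
  if v: "v \<in> J"
proof -
  define t' where "t' = (\<lambda>x. vector_derivative t (at x))"
  define n' where "n' = (\<lambda>x. vector_derivative n (at x))"
  have dt: "(t has_vector_derivative t' v) (at v)"
    unfolding t'_def by (rule smooth_on_has_vector_derivative[OF smooth_t v])
  have dn: "(n has_vector_derivative n' v) (at v)"
    unfolding n'_def using curve v unfolding spherical_curve_def
    by (blast intro: smooth_on_has_vector_derivative)
  have dt': "(t' has_vector_derivative vector_derivative t' (at v)) (at v)"
    using smooth_on_has_vector_derivative[OF smooth_on_vector_derivative[OF smooth_t J_open] v]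
    by (simp add: t'_def)
  have \<kappa>: "\<kappa> = (\<lambda>x. t' x \<bullet> n x)"
    by (simp add: fun_eq_iff spherical_curvature_def t'_def)
  show "\<exists>k. (\<kappa> has_vector_derivative k) (at v)"
    unfolding \<kappa> using has_vector_derivative_inner[OF dt' dn] by blast
  note o = frame_orthonormal
  have const: "a' = 0"
    if "(a has_vector_derivative a') (at v)" "\<And>x. x \<in> J \<Longrightarrow> a x = c"
    for a :: "real \<Rightarrow> real" and a' c
    using has_vector_derivative_eq_on_open[OF that(1) has_vector_derivative_const J_open v that(2)]
    by simp
  have "t v \<bullet> t' v + t' v \<bullet> t v = 0"
    by (rule const[OF has_vector_derivative_inner[OF dt dt] o(2)])
  then have tt: "t' v \<bullet> t v = 0" by (simp add: inner_commute)
  have "r v \<bullet> t' v + t v \<bullet> t v = 0"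
    by (rule const[OF has_vector_derivative_inner[OF deriv_r[OF v] dt] o(4)])
  then have tr: "t' v \<bullet> r v = - 1" using o(2)[OF v] by (simp add: inner_commute)
  have "n v \<bullet> n' v + n' v \<bullet> n v = 0"
    by (rule const[OF has_vector_derivative_inner[OF dn dn] o(3)])
  then have nn: "n' v \<bullet> n v = 0" by (simp add: inner_commute)
  have "n v \<bullet> t' v + n' v \<bullet> t v = 0"
    by (rule const[OF has_vector_derivative_inner[OF dn dt] o(9)])
  then have nt: "n' v \<bullet> t v = - \<kappa> v" by (simp add: \<kappa> inner_commute)
  have "n v \<bullet> t v + n' v \<bullet> r v = 0"
    by (rule const[OF has_vector_derivative_inner[OF dn deriv_r[OF v]] o(7)])
  then have nr: "n' v \<bullet> r v = 0" using o(9)[OF v] by simp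
  have E3: "t' v \<in> E3" "n' v \<in> E3"
  proof -
    have z: "t x $ 4 = 0" "n x $ 4 = 0" if "x \<in> J" for x
      using frame_in_E3[OF that] by (auto simp: in_E3_iff)
    show "t' v \<in> E3"
      using const[OF bounded_linear.has_vector_derivative[OF bounded_linear_vec_nth dt] z(1)]
      by (simp add: in_E3_iff)
    show "n' v \<in> E3"
      using const[OF bounded_linear.has_vector_derivative[OF bounded_linear_vec_nth dn] z(2)]
      by (simp add: in_E3_iff)
  qed
  note expand = E3_orthonormal_expansion[OF frame_in_E3[OF v] _ o(1-3)[OF v] o(4)[OF v] o(6)[OF v] o(8)[OF v]]
  have "t' v = \<kappa> v *\<^sub>R n v - r v"
    by (subst expand[OF E3(1)]) (simp add: tt tr \<kappa>)
  with dt show "(t has_vector_derivative \<kappa> v *\<^sub>R n v - r v) (at v)" by simp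
  have "n' v = - \<kappa> v *\<^sub>R t v"
    by (subst expand[OF E3(2)]) (simp add: nn nr nt)
  with dn show "(n has_vector_derivative - \<kappa> v *\<^sub>R t v) (at v)" by simp
qed

lemma wedge_r_t_deriv:
  assumes "v \<in> J"
  shows "((\<lambda>x. wedge (r x) (t x)) has_vector_derivative \<kappa> v *\<^sub>R wedge (r v) (n v)) (at v)"
  using has_vector_derivative_wedge[OF deriv_r[OF assms] deriv_t[OF assms]]
  by (simp add: wedge_self wedge_scaleR_right wedge_diff_right)

lemma wedge_r_n_deriv:
  assumes "v \<in> J"
  shows "((\<lambda>x. wedge (r x) (n x)) has_vector_derivative
           wedge (t v) (n v) - \<kappa> v *\<^sub>R wedge (r v) (t v)) (at v)"
  using has_vector_derivative_wedge[OF deriv_r[OF assms] deriv_n[OF assms]]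
  by (simp add: wedge_scaleR_right wedge_minus_right)

lemma wedge_t_n_deriv:
  assumes "v \<in> J"
  shows "((\<lambda>x. wedge (t x) (n x)) has_vector_derivative - wedge (r v) (n v)) (at v)"
  using has_vector_derivative_wedge[OF deriv_t[OF assms] deriv_n[OF assms]]
  by (simp add: wedge_self wedge_scaleR_right wedge_scaleR_left wedge_diff_left wedge_minus_right)

text \<open>
  For constant curvature \<open>k\<close> the Darboux vector \<open>k r + n\<close> is constant, and the curve keeps a
  constant inner product with it: it runs in a plane orthogonal to that axis.
\<close>

lemma const_curvature_circle:
  assumes k: "\<And>v. v \<in> J \<Longrightarrow> \<kappa> v = k"
  shows "\<exists>S. circle S \<and> r ` J \<subseteq> S"
proof -
  obtain v0 where v0: "v0 \<in> J" using J_nonempty by blast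
  have "((\<lambda>v. k *\<^sub>R r v + n v) has_vector_derivative 0) (at v)" if "v \<in> J" for v
    using has_vector_derivative_add[OF bounded_linear.has_vector_derivative[OF
        bounded_linear_scaleR_right deriv_r[OF that], of k] deriv_n[OF that]] k[OF that]
    by simp
  then have "\<exists>w. \<forall>v\<in>J. k *\<^sub>R r v + n v = w"
    by (rule zero_derivative_imp_constant[OF J_convex])
  then obtain w where w: "\<And>v. v \<in> J \<Longrightarrow> k *\<^sub>R r v + n v = w" by blast
  have ww: "w \<bullet> w = 1 + k\<^sup>2"
    using frame_orthonormal[OF v0] by (simp add: w[OF v0, symmetric] inner_add_left inner_add_right power2_eq_square)
  have kp: "1 + k\<^sup>2 > 0" by (simp add: add_pos_nonneg)
  have wr: "w \<bullet> r v = k" if "v \<in> J" for v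
    using frame_orthonormal[OF that] by (simp add: w[OF that, symmetric] inner_add_left)
  have wE3: "w \<in> E3"
    using frame_in_E3[OF v0] by (simp add: w[OF v0, symmetric] in_E3_iff)
  have w0: "w \<noteq> 0" using ww kp by auto
  define P where "P = {x. axis 4 1 \<bullet> x = 0} \<inter> {x. w \<bullet> x = k}"
  \<comment> \<open>the foot of the perpendicular from the origin to the plane\<close>
  define c where "c = (k / (1 + k\<^sup>2)) *\<^sub>R w"
  define \<rho> where "\<rho> = sqrt (1 / (1 + k\<^sup>2))"
  have P: "affine P" "aff_dim P = 2"
    using aff_dim_affine_slice[OF wE3 w0 _ wr[OF v0]] frame_in_E3[OF v0]
    by (auto simp: P_def in_E3_iff)
  have cP: "c \<in> P"
    using wE3 ww kp by (simp add: P_def c_def in_E3_iff inner_axis')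
  have rP: "r v \<in> P \<inter> sphere c \<rho>" if "v \<in> J" for v
  proof -
    have "(c - r v) \<bullet> (c - r v) = 1 / (1 + k\<^sup>2)"
      using wr[OF that] ww kp frame_orthonormal[OF that]
      by (simp add: c_def inner_diff_left inner_diff_right inner_commute[of "r v" w] field_simps power2_eq_square)
    then have "dist c (r v) = \<rho>"
      by (simp add: dist_norm norm_eq_sqrt_inner \<rho>_def)
    then show ?thesis
      using frame_in_E3[OF that] wr[OF that] by (simp add: P_def in_E3_iff inner_axis')
  qed
  have "circle (P \<inter> sphere c \<rho>)"
    unfolding circle_def using P cP kp by (auto simp: \<rho>_def intro!: exI[of _ P] exI[of _ c] exI[of _ \<rho>])
  then show ?thesis using rP by blast
qed


end


section \<open>Partial derivatives and the inverse metric\<close>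

text \<open>
  A function of the parameters is known by a formula only over the parameter rectangle.  As the
  rectangle is open, the formula still determines the partial derivatives there.
\<close>

lemma pd_1_eqI:
  assumes "open I" "p \<in> param_domain I J"
    and "\<And>q. q \<in> param_domain I J \<Longrightarrow> \<phi> q = F (q $ 1) (q $ 2)"
    and "((\<lambda>u. F u (p $ 2)) has_vector_derivative d) (at (p $ 1))"
  shows "pd 1 \<phi> p = d"
proof -
  have "((\<lambda>s. p $ 1 + s) has_vector_derivative 1) (at 0)"
    by (auto intro!: derivative_eq_intros)
  from vector_diff_chain_at[OF this, of "\<lambda>u. F u (p $ 2)" d] assms(4)
  have "((\<lambda>s. F (p $ 1 + s) (p $ 2)) has_vector_derivative d) (at 0)"
    by (simp add: o_def)
  then have "((\<lambda>s. \<phi> (p + s *\<^sub>R axis 1 1)) has_vector_derivative d) (at 0)"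
  proof (rule has_vector_derivative_transform_within_open)
    show "open ((\<lambda>s. p $ 1 + s) -` I)"
      by (intro open_vimage assms(1) continuous_intros)
  qed (use assms(2) in \<open>auto simp: param_domain_def assms(3) axis_def\<close>)
  then show ?thesis unfolding pd_def by (rule vector_derivative_at)
qed

lemma pd_2_eqI:
  assumes "open J" "p \<in> param_domain I J"
    and "\<And>q. q \<in> param_domain I J \<Longrightarrow> \<phi> q = F (q $ 1) (q $ 2)"
    and "((\<lambda>v. F (p $ 1) v) has_vector_derivative d) (at (p $ 2))"
  shows "pd 2 \<phi> p = d"
proof -
  have "((\<lambda>s. p $ 2 + s) has_vector_derivative 1) (at 0)"
    by (auto intro!: derivative_eq_intros)
  from vector_diff_chain_at[OF this, of "\<lambda>v. F (p $ 1) v" d] assms(4)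
  have "((\<lambda>s. F (p $ 1) (p $ 2 + s)) has_vector_derivative d) (at 0)"
    by (simp add: o_def)
  then have "((\<lambda>s. \<phi> (p + s *\<^sub>R axis 2 1)) has_vector_derivative d) (at 0)"
  proof (rule has_vector_derivative_transform_within_open)
    show "open ((\<lambda>s. p $ 2 + s) -` J)"
      by (intro open_vimage assms(1) continuous_intros)
  qed (use assms(2) in \<open>auto simp: param_domain_def assms(3) axis_def\<close>)
  then show ?thesis unfolding pd_def by (rule vector_derivative_at)
qed

lemma pd_const: "pd i (\<lambda>q. c) p = 0"
  by (simp add: pd_def)

lemma matrix_inv_diagonal_2:
  fixes A :: "real ^ 2 ^ 2"
  assumes "A $ 1 $ 2 = 0" "A $ 2 $ 1 = 0" "A $ 1 $ 1 \<noteq> 0" "A $ 2 $ 2 \<noteq> 0"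
  shows "matrix_inv A = (\<chi> i j. if i = j then 1 / A $ i $ i else 0)"
proof -
  let ?B = "\<chi> i j. if i = j then 1 / A $ i $ i else 0"
  have B: "A ** ?B = mat 1" "?B ** A = mat 1"
    using assms by (auto simp: matrix_matrix_mult_def vec_eq_iff forall_2 sum_2 mat_def)
  show ?thesis unfolding matrix_inv_def
  proof (rule some_equality)
    fix B' assume "A ** B' = mat 1 \<and> B' ** A = mat 1"
    then show "B' = ?B" using B
      by (metis (no_types) matrix_mul_assoc matrix_mul_lid matrix_mul_rid)
  qed (use B in simp)
qed

section \<open>Geometry of the cone over a spherical curve\<close>

text \<open>
  If \<open>g\<close> is constant then \<open>f\<close> has slope \<open>1\<close> or \<open>-1\<close>, and the meridian surface is the cone
  over the spherical curve with apex \<open>b e\<^sub>4\<close>.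
\<close>

locale flat_meridian_surface = unit_spherical_curve +
  fixes I :: "real set" and f g :: "real \<Rightarrow> real" and \<sigma> a b :: real
  assumes I: "open_interval I"
    and f: "u \<in> I \<Longrightarrow> f u = \<sigma> * u + a"
    and f_nz: "u \<in> I \<Longrightarrow> f u \<noteq> 0"
    and g: "u \<in> I \<Longrightarrow> g u = b"
    and \<sigma>: "\<sigma> * \<sigma> = 1"
begin

abbreviation "z \<equiv> meridian_surface f g r"
abbreviation "D \<equiv> param_domain I J"
abbreviation "\<epsilon> \<equiv> meridian_frame f"

lemma I_open: "open I" and I_nonempty: "I \<noteq> {}"
  using I unfolding open_interval_def by auto

lemma \<sigma>_nz: "\<sigma> \<noteq> 0" using \<sigma> by auto

lemma param_domainD: "p \<in> D \<Longrightarrow> p $ 1 \<in> I" "p \<in> D \<Longrightarrow> p $ 2 \<in> J"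
  by (auto simp: param_domain_def)

lemma z_eq: "q \<in> D \<Longrightarrow> z q = (\<sigma> * q $ 1 + a) *\<^sub>R r (q $ 2) + b *\<^sub>R axis 4 1"
  using f g by (auto simp: param_domain_def meridian_surface_def)

lemmas pd_1 = pd_1_eqI[OF I_open, of _ J]
lemmas pd_2 = pd_2_eqI[OF J_open, of _ I]

lemma pd_z:
  assumes p: "p \<in> D"
  shows "pd 1 z p = \<sigma> *\<^sub>R r (p $ 2)" "pd 2 z p = f (p $ 1) *\<^sub>R t (p $ 2)"
proof -
  show "pd 1 z p = \<sigma> *\<^sub>R r (p $ 2)"
    by (rule pd_1[OF p, where F = "\<lambda>u v. (\<sigma> * u + a) *\<^sub>R r v + b *\<^sub>R axis 4 1"])
      (auto simp: z_eq intro!: derivative_eq_intros)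
  show "pd 2 z p = f (p $ 1) *\<^sub>R t (p $ 2)"
    by (rule pd_2[OF p, where F = "\<lambda>u v. (\<sigma> * u + a) *\<^sub>R r v + b *\<^sub>R axis 4 1"])
      (auto simp: z_eq f param_domainD[OF p] intro!: derivative_eq_intros deriv_r)
qed

lemma first_form_z:
  assumes "p \<in> D"
  shows "first_form z p $ i $ j = (if i \<noteq> j then 0 else if i = 1 then 1 else (f (p $ 1))\<^sup>2)"
  using frame_orthonormal[OF param_domainD(2)[OF assms]] exhaust_2[of i] exhaust_2[of j] \<sigma>
  by (auto simp: first_form_def pd_z[OF assms] power2_eq_square)

lemma pd_first_form:
  assumes p: "p \<in> D"
  shows "pd k (\<lambda>q. first_form z q $ i $ j) p =
     (if k = 1 \<and> i = 2 \<and> j = 2 then 2 * \<sigma> * f (p $ 1) else 0)"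
proof -
  define F where "F = (\<lambda>(u::real) (v::real). if i \<noteq> j then 0 else if i = 1 then 1 else (\<sigma> * u + a)\<^sup>2)"
  have eq: "first_form z q $ i $ j = F (q $ 1) (q $ 2)" if "q \<in> D" for q
    using f[OF param_domainD(1)[OF that]] by (simp add: first_form_z[OF that] F_def)
  have "pd 1 (\<lambda>q. first_form z q $ i $ j) p = (if i = 2 \<and> j = 2 then 2 * \<sigma> * f (p $ 1) else 0)"
    by (rule pd_1[where F = F, OF p eq], assumption, cases "i = j"; cases "i = 1")
      (use exhaust_2[of i] exhaust_2[of j] in
        \<open>auto simp: F_def f[OF param_domainD(1)[OF p]] has_real_derivative_iff_has_vector_derivative[symmetric] intro!: derivative_eq_intros\<close>)
  moreover have "pd 2 (\<lambda>q. first_form z q $ i $ j) p = 0"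
    by (rule pd_2[where F = F, OF p eq]) (simp_all add: F_def)
  ultimately show ?thesis using exhaust_2[of k] by auto
qed

lemma christoffel_z:
  assumes p: "p \<in> D"
  shows "christoffel z k i j p =
    (if k = 1 \<and> i = 2 \<and> j = 2 then - \<sigma> * f (p $ 1) else if k = 2 \<and> i \<noteq> j then \<sigma> / f (p $ 1) else 0)"
proof -
  have fp: "f (p $ 1) \<noteq> 0" using f_nz param_domainD(1)[OF p] by blast
  have "matrix_inv (first_form z p) = (\<chi> i j. if i = j then 1 / first_form z p $ i $ i else 0)"
    by (rule matrix_inv_diagonal_2) (use fp in \<open>auto simp: first_form_z[OF p]\<close>)
  then show ?thesis
    unfolding christoffel_def using exhaust_2[of k] exhaust_2[of i] exhaust_2[of j] fp
    by (auto simp: sum_2 first_form_z[OF p] pd_first_form[OF p] power2_eq_square)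
qed

text \<open>This is the Levi-Civita connection of a plane in polar coordinates with signed radius \<open>f\<close>.\<close>

lemma levi_civita_z:
  assumes "p \<in> D"
  shows "levi_civita z X Y p $ 1 = flat_deriv X (\<lambda>q. Y q $ 1) p - \<sigma> * f (p $ 1) * X p $ 2 * Y p $ 2"
    "levi_civita z X Y p $ 2 = flat_deriv X (\<lambda>q. Y q $ 2) p + \<sigma> / f (p $ 1) * (X p $ 1 * Y p $ 2 + X p $ 2 * Y p $ 1)"
  by (simp_all add: levi_civita_def sum_2 christoffel_z[OF assms] algebra_simps)

text \<open>
  Both iterated covariant derivatives of the second coordinate field equal minus the first
  coordinate field, because the slope of \<open>f\<close> has square one.
\<close>

lemma gauss_curvature_z:
  assumes p: "p \<in> D"
  shows "gauss_curvature z p = 0"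
proof -
  define X where "X = (\<lambda>i::2. \<lambda>q::real ^ 2. axis i 1 :: real ^ 2)"
  have const: "flat_deriv Y (\<lambda>q. c) q = 0" for Y q and c :: real
    by (simp add: flat_deriv_def sum_2 pd_def)
  have X: "X 1 q $ 1 = 1" "X 1 q $ 2 = 0" "X 2 q $ 1 = 0" "X 2 q $ 2 = 1" for q
    by (auto simp: X_def axis_def)
  note lc = levi_civita_z X const
  have 22: "levi_civita z (X 2) (X 2) q $ 1 = - \<sigma> * (\<sigma> * q $ 1 + a)" "levi_civita z (X 2) (X 2) q $ 2 = 0"
    and 12: "levi_civita z (X 1) (X 2) q $ 1 = 0" "levi_civita z (X 1) (X 2) q $ 2 = \<sigma> / (\<sigma> * q $ 1 + a)"
    if "q \<in> D" for q
    using that f[OF param_domainD(1)[OF that]] by (simp_all add: lc)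
  have fp: "f (p $ 1) \<noteq> 0" and fp': "f (p $ 1) = \<sigma> * p $ 1 + a" using f f_nz param_domainD(1)[OF p] by auto
  have pds: "pd 1 (\<lambda>q. levi_civita z (X 2) (X 2) q $ 1) p = - \<sigma> * \<sigma>"
    "pd 1 (\<lambda>q. levi_civita z (X 2) (X 2) q $ 2) p = 0"
    "pd 2 (\<lambda>q. levi_civita z (X 1) (X 2) q $ 1) p = 0"
    "pd 2 (\<lambda>q. levi_civita z (X 1) (X 2) q $ 2) p = 0"
    by (rule pd_1[where F = "\<lambda>u v. - \<sigma> * (\<sigma> * u + a)", OF p 22(1)]
          pd_1[where F = "\<lambda>u v. 0", OF p 22(2)]
          pd_2[where F = "\<lambda>u v. 0", OF p 12(1)]
          pd_2[where F = "\<lambda>u v. \<sigma> / (\<sigma> * u + a)", OF p 12(2)];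
        auto simp: has_real_derivative_iff_has_vector_derivative[symmetric] intro!: derivative_eq_intros)+
  have "levi_civita z (X 1) (levi_civita z (X 2) (X 2)) p = levi_civita z (X 2) (levi_civita z (X 1) (X 2)) p"
    using p fp \<sigma> by (simp add: vec_eq_iff forall_2 levi_civita_z X 12 22 flat_deriv_def sum_2 pds pd_const fp')
  then show ?thesis
    unfolding gauss_curvature_def X_def[symmetric] Let_def flat_deriv_def by simp
qed

lemma gauss_map_z:
  assumes "p \<in> D"
  shows "gauss_map z \<epsilon> p = \<sigma> *\<^sub>R wedge (r (p $ 2)) (t (p $ 2))"
  using f_nz[OF param_domainD(1)[OF assms]]
  by (simp add: gauss_map_def flat_deriv_def sum_2 meridian_frame_def pd_z[OF assms] axis_def
      wedge_scaleR_left wedge_scaleR_right)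

text \<open>
  The field is constant along the rulings \<open>v = const\<close>, which are geodesics, so their direction
  contributes nothing.  The acceleration of the curves \<open>u = const\<close> in the surface points along the rulings, so a field that
  depends on \<open>v\<close> alone does not see the correction term.
\<close>

lemma laplacian_of_v:
  fixes \<phi> :: "real ^ 2 \<Rightarrow> 'b::real_normed_vector"
  assumes p: "p \<in> D" and \<phi>: "\<And>q. q \<in> D \<Longrightarrow> \<phi> q = \<Phi> (q $ 2)"
    and d1: "\<And>v. v \<in> J \<Longrightarrow> (\<Phi> has_vector_derivative \<Phi>' v) (at v)"
    and d2: "(\<Phi>' has_vector_derivative \<Phi>'') (at (p $ 2))"
  shows "laplacian z \<epsilon> \<phi> p = - (1 / (f (p $ 1))\<^sup>2) *\<^sub>R \<Phi>''"
proof -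
  have pd: "pd 1 \<phi> q = 0" "pd 2 \<phi> q = \<Phi>' (q $ 2)" if "q \<in> D" for q
    by (rule pd_1[where F = "\<lambda>u. \<Phi>", OF that \<phi>] pd_2[where F = "\<lambda>u. \<Phi>", OF that \<phi>]; use d1 param_domainD[OF that] in auto)+
  have e: "\<epsilon> 1 q $ 1 = 1" "\<epsilon> 1 q $ 2 = 0" "\<epsilon> 2 q $ 1 = 0" "\<epsilon> 2 q $ 2 = 1 / f (q $ 1)" for q
    by (auto simp: meridian_frame_def axis_def)
  have f1: "flat_deriv (\<epsilon> 1) \<phi> q = 0" and f2: "flat_deriv (\<epsilon> 2) \<phi> q = (1 / f (q $ 1)) *\<^sub>R \<Phi>' (q $ 2)"
    if "q \<in> D" for q
    using that by (simp_all add: flat_deriv_def sum_2 e pd)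
  have "pd 1 (flat_deriv (\<epsilon> 1) \<phi>) p = 0"
    by (rule pd_1[where F = "\<lambda>u v. 0", OF p f1]) auto
  then have 1: "flat_deriv (\<epsilon> 1) (flat_deriv (\<epsilon> 1) \<phi>) p = 0"
    by (simp add: flat_deriv_def[of "\<epsilon> 1" "flat_deriv (\<epsilon> 1) \<phi>"] sum_2 e)
  have "pd 2 (flat_deriv (\<epsilon> 2) \<phi>) p = (1 / f (p $ 1)) *\<^sub>R \<Phi>''"
    by (rule pd_2[where F = "\<lambda>u v. (1 / f u) *\<^sub>R \<Phi>' v", OF p f2]) (auto intro!: derivative_eq_intros d2)
  then have 2: "flat_deriv (\<epsilon> 2) (flat_deriv (\<epsilon> 2) \<phi>) p = (1 / (f (p $ 1))\<^sup>2) *\<^sub>R \<Phi>''"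
    by (simp add: flat_deriv_def[of "\<epsilon> 2" "flat_deriv (\<epsilon> 2) \<phi>"] sum_2 e power2_eq_square)
  have "pd 2 (\<lambda>q. 1 / f (q $ 1)) p = 0"
    by (rule pd_2[where F = "\<lambda>u v. 1 / f u", OF p]) auto
  moreover have "flat_deriv (\<epsilon> 1) (\<lambda>q. 0) p = 0" "pd 1 (\<lambda>q. 0::real) p = 0" "pd 2 (\<lambda>q. 0::real) p = 0"
    by (simp_all add: flat_deriv_def pd_def)
  ultimately have "levi_civita z (\<epsilon> i) (\<epsilon> i) p $ 2 = 0" for i
    using exhaust_2[of i] by (auto simp: levi_civita_z[OF p] e flat_deriv_def sum_2)
  then have 3: "flat_deriv (levi_civita z (\<epsilon> i) (\<epsilon> i)) \<phi> p = 0" for i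
    by (simp add: flat_deriv_def sum_2 pd[OF p])
  show ?thesis by (simp add: laplacian_def sum_2 1 2 3)
qed

lemma D_open: "open D"
proof -
  have "D = (\<lambda>p. p $ 1) -` I \<inter> (\<lambda>p. p $ 2) -` J" by (auto simp: param_domain_def)
  then show ?thesis by (simp add: open_Int open_vimage I_open J_open continuous_intros)
qed

section \<open>The Laplacian equation of the Gauss map\<close>

lemma laplacian_gauss_map:
  assumes p: "p \<in> D" and k: "(\<kappa> has_vector_derivative k') (at (p $ 2))"
  shows "laplacian z \<epsilon> (gauss_map z \<epsilon>) p = - (\<sigma> / (f (p $ 1))\<^sup>2) *\<^sub>R
    (k' *\<^sub>R wedge (r (p $ 2)) (n (p $ 2)) + \<kappa> (p $ 2) *\<^sub>R
      (wedge (t (p $ 2)) (n (p $ 2)) - \<kappa> (p $ 2) *\<^sub>R wedge (r (p $ 2)) (t (p $ 2))))"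
proof -
  let ?v = "p $ 2"
  let ?G'' = "k' *\<^sub>R wedge (r ?v) (n ?v) + \<kappa> ?v *\<^sub>R (wedge (t ?v) (n ?v) - \<kappa> ?v *\<^sub>R wedge (r ?v) (t ?v))"
  have "((\<lambda>v. \<sigma> *\<^sub>R \<kappa> v *\<^sub>R wedge (r v) (n v)) has_vector_derivative \<sigma> *\<^sub>R ?G'') (at ?v)"
    using bounded_linear.has_vector_derivative[OF bounded_linear_scaleR_right
        bounded_bilinear.has_vector_derivative[OF bounded_bilinear_scaleR k wedge_r_n_deriv[OF param_domainD(2)[OF p]]]]
    by (simp add: add.commute)
  moreover have "((\<lambda>v. \<sigma> *\<^sub>R wedge (r v) (t v)) has_vector_derivative
      \<sigma> *\<^sub>R \<kappa> v *\<^sub>R wedge (r v) (n v)) (at v)" if "v \<in> J" for v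
    by (rule bounded_linear.has_vector_derivative[OF bounded_linear_scaleR_right wedge_r_t_deriv[OF that]])
  ultimately
  have "laplacian z \<epsilon> (gauss_map z \<epsilon>) p = - (1 / (f (p $ 1))\<^sup>2) *\<^sub>R \<sigma> *\<^sub>R ?G''"
    by (intro laplacian_of_v[where \<Phi> = "\<lambda>v. \<sigma> *\<^sub>R wedge (r v) (t v)", OF p gauss_map_z])
  then show ?thesis by simp
qed

text \<open>
  Write \<open>c\<^sub>1, c\<^sub>2, c\<^sub>3\<close> for the coordinates of \<open>C\<close> along \<open>r \<and> t\<close>, \<open>r \<and> n\<close>, \<open>t \<and> n\<close>.  Along one
  parameter curve \<open>u = u\<^sub>0\<close> the Laplacian equation says \<open>\<kappa> = m c\<^sub>3\<close>, \<open>\<kappa>' = m c\<^sub>2\<close> and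
  \<open>- \<kappa>\<^sup>2 = m (\<sigma> + c\<^sub>1)\<close> with a nowhere vanishing \<open>m\<close>.  Eliminating \<open>m\<close> gives
  \<open>\<sigma> + c\<^sub>1 + \<kappa> c\<^sub>3 = 0\<close>.  Since \<open>C\<close> is constant, the Frenet equations give \<open>c\<^sub>1' = \<kappa> c\<^sub>2\<close> and
  \<open>c\<^sub>3' = - c\<^sub>2\<close>, and differentiating the relation leaves \<open>\<kappa>' c\<^sub>3 = 0\<close>.  Hence \<open>c\<^sub>2 c\<^sub>3 = 0\<close>, so
  \<open>c\<^sub>3\<^sup>2\<close> is constant: either \<open>c\<^sub>3 = 0\<close> throughout and \<open>\<kappa> = 0\<close>, or \<open>c\<^sub>3\<close> vanishes nowhere and
  \<open>\<kappa>' = 0\<close>.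
\<close>

lemma curvature_constant_if_second_kind:
  assumes "pointwise_1type_with D z \<epsilon> C" and C: "C \<in> bivectors"
  shows "\<exists>k. \<forall>v\<in>J. \<kappa> v = k"
proof -
  obtain lam where lam: "\<And>p. p \<in> D \<Longrightarrow> lam p \<noteq> 0"
    and lap: "\<And>p. p \<in> D \<Longrightarrow> laplacian z \<epsilon> (gauss_map z \<epsilon>) p = lam p *\<^sub>R (gauss_map z \<epsilon> p + C)"
    using assms(1) unfolding pointwise_1type_with_def by blast
  obtain u0 where u0: "u0 \<in> I" using I_nonempty by blast
  define k' where "k' = (\<lambda>v. vector_derivative \<kappa> (at v))"
  have k': "(\<kappa> has_vector_derivative k' v) (at v)" if "v \<in> J" for v
    using spherical_curvature_differentiable[OF that] vector_derivative_at unfolding k'_def by metis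
  define c1 where "c1 = (\<lambda>v. form C (r v) (t v))"
  define c2 where "c2 = (\<lambda>v. form C (r v) (n v))"
  define c3 where "c3 = (\<lambda>v. form C (t v) (n v))"
  have d1: "(c1 has_vector_derivative \<kappa> v * c2 v) (at v)" if "v \<in> J" for v
    using has_vector_derivative_form[OF deriv_r[OF that] deriv_t[OF that], of C]
    by (simp add: c1_def c2_def form_simps form_self[OF C])
  have d3: "(c3 has_vector_derivative - c2 v) (at v)" if "v \<in> J" for v
    using has_vector_derivative_form[OF deriv_t[OF that] deriv_n[OF that], of C]
    by (simp add: c3_def c2_def form_simps form_self[OF C])
  define m where "m = (\<lambda>v. - \<sigma> * (f u0)\<^sup>2 * lam (vector [u0, v]))"
  \<comment> \<open>the three coefficients, read off by evaluating on pairs of frame vectors\<close>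
  have m: "m v \<noteq> 0" and E1: "\<kappa> v = m v * c3 v" and E2: "k' v = m v * c2 v"
    and E3: "- (\<kappa> v)\<^sup>2 = m v * (\<sigma> + c1 v)" if v: "v \<in> J" for v
  proof -
    define p where "p = (vector [u0, v] :: real ^ 2)"
    have p: "p $ 1 = u0" "p $ 2 = v" "p \<in> D" using u0 v by (auto simp: p_def param_domain_def)
    have F: "(f u0)\<^sup>2 \<noteq> 0" using f_nz[OF u0] by simp
    show "m v \<noteq> 0" using F \<sigma>_nz lam[OF p(3)] by (simp add: m_def p_def)
    note o = frame_orthonormal[OF v]
    have eq: "- (\<sigma> / (f u0)\<^sup>2) *\<^sub>R (k' v *\<^sub>R wedge (r v) (n v) + \<kappa> v *\<^sub>R
        (wedge (t v) (n v) - \<kappa> v *\<^sub>R wedge (r v) (t v))) = lam p *\<^sub>R (\<sigma> *\<^sub>R wedge (r v) (t v) + C)"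
      using lap[OF p(3)] laplacian_gauss_map[OF p(3)] gauss_map_z[OF p(3)] k'[OF v] by (simp add: p)
    have e: "- (\<sigma> / (f u0)\<^sup>2) * (k' v * form (wedge (r v) (n v)) x y + \<kappa> v *
        (form (wedge (t v) (n v)) x y - \<kappa> v * form (wedge (r v) (t v)) x y)) =
        lam p * (\<sigma> * form (wedge (r v) (t v)) x y + form C x y)" for x y
      using arg_cong[OF eq, of "\<lambda>A. form A x y"] by (simp only: form_add form_diff form_scaleR)
    have E: "k' v * form (wedge (r v) (n v)) x y + \<kappa> v *
        (form (wedge (t v) (n v)) x y - \<kappa> v * form (wedge (r v) (t v)) x y) =
        m v * (\<sigma> * form (wedge (r v) (t v)) x y + form C x y)" for x y
    proof -
      let ?X = "k' v * form (wedge (r v) (n v)) x y + \<kappa> v *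
        (form (wedge (t v) (n v)) x y - \<kappa> v * form (wedge (r v) (t v)) x y)"
      have "?X = - \<sigma> * (f u0)\<^sup>2 * (- (\<sigma> / (f u0)\<^sup>2) * ?X)"
        using F \<sigma> by simp
      then show ?thesis unfolding e by (simp add: m_def p_def)
    qed
    show "\<kappa> v = m v * c3 v" using E[of "t v" "n v"] o by (simp add: form_wedge c3_def)
    show "k' v = m v * c2 v" using E[of "r v" "n v"] o by (simp add: form_wedge c2_def)
    show "- (\<kappa> v)\<^sup>2 = m v * (\<sigma> + c1 v)" using E[of "r v" "t v"] o
      by (simp add: form_wedge c1_def power2_eq_square)
  qed
  have "\<sigma> + c1 v = - (\<kappa> v * c3 v)" if "v \<in> J" for v
  proof -
    have "m v * (\<sigma> + c1 v) = m v * (- (\<kappa> v * c3 v))"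
    proof -
      have "m v * (\<sigma> + c1 v) = - (\<kappa> v * (m v * c3 v))"
        using E3[OF that] E1[OF that] by (simp add: power2_eq_square)
      then show ?thesis by (simp add: algebra_simps)
    qed
    then show ?thesis unfolding mult_left_cancel[OF m[OF that]] .
  qed
  then have eq: "\<sigma> + c1 v + \<kappa> v * c3 v = 0" if "v \<in> J" for v
    using that by simp
  have k3: "k' v * c3 v = 0" if v: "v \<in> J" for v
  proof -
    have "((\<lambda>v. \<sigma> + c1 v + \<kappa> v * c3 v) has_vector_derivative
        (0 + \<kappa> v * c2 v) + (\<kappa> v * (- c2 v) + k' v * c3 v)) (at v)"
      by (intro has_vector_derivative_add has_vector_derivative_mult has_vector_derivative_const
          d1 d3 k' v)
    from has_vector_derivative_eq_on_open[OF this has_vector_derivative_const J_open v eq]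
    show ?thesis by simp
  qed
  then have c23: "c2 v * c3 v = 0" if "v \<in> J" for v
    using E2[OF that] m[OF that] k3[OF that] by simp
  have "((\<lambda>v. c3 v * c3 v) has_vector_derivative 0) (at v)" if v: "v \<in> J" for v
    using has_vector_derivative_mult[OF d3[OF v] d3[OF v]] c23[OF v] by (simp add: mult.commute)
  then have "\<exists>s. \<forall>v\<in>J. c3 v * c3 v = s"
    by (rule zero_derivative_imp_constant[OF J_convex])
  then obtain s where s: "\<And>v. v \<in> J \<Longrightarrow> c3 v * c3 v = s" by blast
  show ?thesis
  proof (cases "s = 0")
    case True
    then show ?thesis using s E1 by auto
  next
    case False
    then have "k' v = 0" if "v \<in> J" for v using k3[OF that] s[OF that] by auto
    then have "(\<kappa> has_vector_derivative 0) (at v)" if "v \<in> J" for v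
      using k'[OF that] that by simp
    then have "\<exists>k. \<forall>v\<in>J. \<kappa> v = k"
      by (rule zero_derivative_imp_constant[OF J_convex])
    then obtain k where "\<And>v. v \<in> J \<Longrightarrow> \<kappa> v = k" by blast
    then show ?thesis by blast
  qed
qed

text \<open>
  The coordinate relations of the previous lemma leave one candidate: \<open>c\<^sub>2 = 0\<close>, and then
  \<open>c\<^sub>3 = k c\<^sub>1\<close> together with \<open>\<sigma> + c\<^sub>1 + k c\<^sub>3 = 0\<close> forces \<open>c\<^sub>1 = - \<sigma> / (1 + k\<^sup>2)\<close>.  For \<open>k = 0\<close> this is
  \<open>C = - G\<close> with a constant Gauss map, and the equation degenerates to \<open>0 = 0\<close>.
\<close>

lemma second_kind_if_curvature_constant:
  assumes k: "\<And>v. v \<in> J \<Longrightarrow> \<kappa> v = k"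
  shows "pointwise_1type_second_kind D z \<epsilon>"
proof -
  obtain v0 where v0: "v0 \<in> J" using J_nonempty by blast
  define W where "W = (\<lambda>v. wedge (r v) (t v) + k *\<^sub>R wedge (t v) (n v))"
  define C where "C = (- \<sigma> / (1 + k\<^sup>2)) *\<^sub>R W v0"
  have kp: "1 + k\<^sup>2 \<noteq> 0" by (simp add: add_pos_nonneg less_imp_neq[symmetric])
  have "(W has_vector_derivative 0) (at v)" if v: "v \<in> J" for v
  proof -
    have "(W has_vector_derivative k *\<^sub>R wedge (r v) (n v) + k *\<^sub>R (- wedge (r v) (n v))) (at v)"
      unfolding W_def using wedge_r_t_deriv[OF v] k[OF v]
      by (intro has_vector_derivative_add bounded_linear.has_vector_derivative[OF
          bounded_linear_scaleR_right wedge_t_n_deriv[OF v]]) simp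
    then show ?thesis by simp
  qed
  then have "\<exists>W0. \<forall>v\<in>J. W v = W0"
    by (rule zero_derivative_imp_constant[OF J_convex])
  then obtain W0 where W0: "\<And>v. v \<in> J \<Longrightarrow> W v = W0" by blast
  then have W: "W v = W v0" if "v \<in> J" for v using that v0 by simp
  have "W v0 = wedge (r v0 - k *\<^sub>R n v0) (t v0)"
    by (simp add: W_def wedge_diff_left wedge_scaleR_left wedge_anti[of "n v0"])
  then have "C \<in> bivectors" unfolding C_def by (simp only: scaleR_wedge_in_bivectors)
  moreover have "form C (r v0) (t v0) \<noteq> 0"
    using frame_orthonormal[OF v0] kp \<sigma>_nz unfolding C_def W_def form_scaleR form_add form_wedge by simp
  then have "C \<noteq> 0" using form_zero by metis
  moreover have "pointwise_1type_with D z \<epsilon> C"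
    unfolding pointwise_1type_with_def
  proof (intro exI conjI ballI)
    let ?lam = "\<lambda>p::real ^ 2. (1 + k\<^sup>2) * inverse (\<sigma> * p $ 1 + a) ^ 2"
    have nz: "\<sigma> * p $ 1 + a \<noteq> 0" if "p \<in> D" for p
      using f f_nz param_domainD(1)[OF that] by metis
    show "smooth_on ?lam D"
      by (rule smooth_on_inverse_power_affine[OF D_open nz])
    fix p assume p: "p \<in> D"
    show "?lam p \<noteq> 0" using kp nz[OF p] by simp
    let ?v = "p $ 2"
    have v: "?v \<in> J" using param_domainD(2)[OF p] .
    have "(\<kappa> has_vector_derivative 0) (at ?v)"
      by (rule has_vector_derivative_transform_within_open[OF has_vector_derivative_const J_open v])
        (simp add: k)
    from laplacian_gauss_map[OF p this]
    have "laplacian z \<epsilon> (gauss_map z \<epsilon>) p = - (\<sigma> / (f (p $ 1))\<^sup>2) *\<^sub>R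
      (k *\<^sub>R (wedge (t ?v) (n ?v) - k *\<^sub>R wedge (r ?v) (t ?v)))"
      by (simp add: k[OF v])
    also have "\<dots> = ((1 + k\<^sup>2) / (f (p $ 1))\<^sup>2) *\<^sub>R
       (\<sigma> *\<^sub>R wedge (r ?v) (t ?v) + (- \<sigma> / (1 + k\<^sup>2)) *\<^sub>R W ?v)"
    proof -
      have alg: "q / F * (\<sigma> * x + (- \<sigma> / q) * y) = \<sigma> / F * (q * x - y)"
        if "q \<noteq> 0" "F \<noteq> 0" for q F x y :: real
        using that by (simp add: field_simps)
      show ?thesis
        using f_nz[OF param_domainD(1)[OF p]] alg[OF kp, of "(f (p $ 1))\<^sup>2"]
        by (simp add: W_def vec_eq_iff) (simp add: algebra_simps diff_divide_distrib power2_eq_square)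
    qed
    also have "\<dots> = ?lam p *\<^sub>R (gauss_map z \<epsilon> p + C)"
      by (simp add: gauss_map_z[OF p] C_def W[OF v] f[OF param_domainD(1)[OF p]] power2_eq_square divide_inverse)
    finally show "laplacian z \<epsilon> (gauss_map z \<epsilon>) p = ?lam p *\<^sub>R (gauss_map z \<epsilon> p + C)" .
  qed
  ultimately show ?thesis unfolding pointwise_1type_second_kind_def by blast
qed

section \<open>Containing planes and hyperplanes, and the ruling\<close>

text \<open>A curve with vanishing spherical curvature has a constant normal \<open>n\<close>.\<close>

lemma lies_in_plane_if_curvature_zero:
  assumes k: "\<And>v. v \<in> J \<Longrightarrow> \<kappa> v = 0"
  shows "lies_in_dim 2 (z ` D)"
proof -
  obtain v0 where v0: "v0 \<in> J" using J_nonempty by blast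
  have "(n has_vector_derivative 0) (at v)" if "v \<in> J" for v
    using deriv_n[OF that] k[OF that] by simp
  then have "\<exists>w. \<forall>v\<in>J. n v = w"
    by (rule zero_derivative_imp_constant[OF J_convex])
  then obtain w where w: "\<And>v. v \<in> J \<Longrightarrow> n v = w" by blast
  have w0: "w \<in> E3" "w \<noteq> 0"
    using frame_in_E3(3)[OF v0] frame_orthonormal(3)[OF v0] w[OF v0] by auto
  let ?x0 = "b *\<^sub>R axis 4 1 :: real ^ 4"
  have x0: "?x0 $ 4 = b" "w \<bullet> ?x0 = 0"
    using w0(1) by (simp_all add: in_E3_iff inner_axis)
  have "z p \<in> {x. axis 4 1 \<bullet> x = b} \<inter> {x. w \<bullet> x = 0}" if p: "p \<in> D" for p
    using x0 frame_in_E3(1)[OF param_domainD(2)[OF p]] frame_orthonormal(7)[OF param_domainD(2)[OF p]] w[OF param_domainD(2)[OF p]]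
    by (simp add: z_eq[OF p] in_E3_iff inner_axis' inner_add_right)
  then show ?thesis
    unfolding lies_in_dim_def using aff_dim_affine_slice[OF w0 x0] by blast
qed

text \<open>
  A direction orthogonal to the plane is orthogonal to \<open>r\<close> by differentiating in \<open>u\<close>, hence to \<open>t\<close>
  and \<open>t'\<close>.  Where \<open>\<kappa>\<close> is nonzero it is then orthogonal to \<open>n\<close> as well, so the whole frame, of
  three independent vectors, lies in the two-dimensional direction space of the plane.
\<close>

lemma curvature_zero_if_lies_in_plane:
  assumes "lies_in_dim 2 (z ` D)" and v: "v \<in> J"
  shows "\<kappa> v = 0"
proof (rule ccontr)
  assume \<kappa>: "\<kappa> v \<noteq> 0"
  obtain H where H: "affine H" "aff_dim H = 2" "z ` D \<subseteq> H"
    using assms(1) unfolding lies_in_dim_def by blast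
  have "H \<noteq> {}" using H(2) by auto
  then obtain h where h: "h \<in> H" by blast
  define L where "L = (\<lambda>x. x - h) ` H"
  have L: "subspace L" using affine_diffs_subspace_subtract[OF H(1) h] by (simp add: L_def)
  have dimL: "dim L = 2"
    using H(2) h by (simp add: L_def aff_dim_eq_dim_subtract[of h H] hull_inc)
  have ortho: "y \<bullet> r v = 0 \<and> y \<bullet> t v = 0 \<and> y \<bullet> n v = 0" if y: "y \<in> L\<^sup>\<bottom>" for y
  proof -
    have const: "y \<bullet> z p = y \<bullet> h" if "p \<in> D" for p
    proof -
      have "z p - h \<in> L" using H(3) that by (auto simp: L_def)
      then show ?thesis using y by (auto simp: orthogonal_comp_def orthogonal_def inner_diff_right inner_diff_left inner_commute)
    qed
    obtain u0 where u0: "u0 \<in> I" using I_nonempty by blast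
    have r0: "y \<bullet> r x = 0" if x: "x \<in> J" for x
    proof -
      have "y \<bullet> ((\<sigma> * u + a) *\<^sub>R r x + b *\<^sub>R axis 4 1) = y \<bullet> h" if "u \<in> I" for u
        using const[of "vector [u, x]"] z_eq[of "vector [u, x]"] that x by (simp add: param_domain_def)
      moreover have "((\<lambda>u. y \<bullet> ((\<sigma> * u + a) *\<^sub>R r x + b *\<^sub>R axis 4 1)) has_vector_derivative
          y \<bullet> (\<sigma> *\<^sub>R r x)) (at u0)"
        by (rule bounded_linear.has_vector_derivative[OF bounded_linear_inner_right])
          (auto intro!: derivative_eq_intros)
      ultimately have "y \<bullet> (\<sigma> *\<^sub>R r x) = 0"
        using has_vector_derivative_eq_on_open[OF _ has_vector_derivative_const I_open u0] by blast
      then show ?thesis using \<sigma>_nz by simp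
    qed
    have t0: "y \<bullet> t x = 0" if x: "x \<in> J" for x
      using has_vector_derivative_eq_on_open[OF bounded_linear.has_vector_derivative[OF
          bounded_linear_inner_right deriv_r[OF x]] has_vector_derivative_const J_open x r0] .
    have "y \<bullet> (\<kappa> v *\<^sub>R n v - r v) = 0"
      using has_vector_derivative_eq_on_open[OF bounded_linear.has_vector_derivative[OF
          bounded_linear_inner_right deriv_t[OF v]] has_vector_derivative_const J_open v t0] .
    then show ?thesis using r0[OF v] t0[OF v] \<kappa> by (simp add: inner_diff_right)
  qed
  note o = frame_orthonormal[OF v]
  have "{r v, t v, n v} \<subseteq> L\<^sup>\<bottom>\<^sup>\<bottom>"
    using ortho unfolding orthogonal_comp_def[of "L\<^sup>\<bottom>"] by (auto simp: orthogonal_def inner_commute)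
  then have "{r v, t v, n v} \<subseteq> L" using orthogonal_comp_self[OF L] by simp
  moreover have "independent {r v, t v, n v}"
    by (rule pairwise_orthogonal_independent) (use o in \<open>auto simp: pairwise_insert orthogonal_def\<close>)
  moreover have "card {r v, t v, n v} = 3"
  proof -
    have "r v \<noteq> t v" "r v \<noteq> n v" "t v \<noteq> n v" using o by auto
    then show ?thesis by simp
  qed
  ultimately show False using independent_card_le_dim[of "{r v, t v, n v}" L] dimL by simp
qed

lemma lies_in_hyperplane: "lies_in_dim 3 (z ` D)"
proof -
  have "z ` D \<subseteq> {x. axis 4 1 \<bullet> x = b}"
    using frame_in_E3(1) by (auto simp: z_eq in_E3_iff inner_axis' param_domainD)
  moreover have "aff_dim {x :: real ^ 4. axis 4 1 \<bullet> x = b} = 3"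
    by (subst aff_dim_hyperplane) (simp_all add: axis_eq_0_iff)
  ultimately show ?thesis
    unfolding lies_in_dim_def by (intro exI[of _ "{x. axis 4 1 \<bullet> x = b}"]) (simp add: affine_hyperplane)
qed

lemma ruled_surface_z: "ruled_surface (z ` D)"
  unfolding ruled_surface_def
proof (rule exI[of _ "(\<lambda>u. \<sigma> * u + a) ` I"], rule exI[of _ J], rule exI[of _ "\<lambda>v. b *\<^sub>R axis 4 1"],
    rule exI[of _ r], intro conjI ballI)
  let ?K = "(\<lambda>u. \<sigma> * u + a) ` I"
  show "open_interval ?K"
    unfolding open_interval_def
  proof (intro conjI)
    \<comment> \<open>\<open>\<sigma>\<close> is its own inverse\<close>
    have "?K = (\<lambda>s. \<sigma> * (s - a)) -` I"
    proof (intro equalityI subsetI)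
      fix s assume "s \<in> (\<lambda>s. \<sigma> * (s - a)) -` I"
      moreover have "s = \<sigma> * (\<sigma> * (s - a)) + a" by (simp add: mult.assoc[symmetric] \<sigma>)
      ultimately show "s \<in> ?K" by (intro image_eqI[of _ _ "\<sigma> * (s - a)"]) auto
    qed (auto simp: mult.assoc[symmetric] \<sigma>)
    then show "open ?K" by (simp add: open_vimage I_open continuous_intros)
    show "is_interval ?K"
      unfolding is_interval_connected_1
      using I by (intro connected_continuous_image continuous_intros)
        (simp add: open_interval_def is_interval_connected_1)
    show "?K \<noteq> {}" using I_nonempty by simp
  qed
  show "open_interval J" "smooth_on r J"
    using curve unfolding spherical_curve_def by auto
  show "smooth_on (\<lambda>v. b *\<^sub>R axis 4 1) J" by (rule smooth_on_const)
  show "z ` D = {b *\<^sub>R axis 4 1 + s *\<^sub>R r v | s v. s \<in> ?K \<and> v \<in> J}"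
  proof (intro equalityI subsetI)
    fix x assume "x \<in> z ` D"
    then obtain p where p: "p \<in> D" "x = z p" by blast
    then show "x \<in> {b *\<^sub>R axis 4 1 + s *\<^sub>R r v | s v. s \<in> ?K \<and> v \<in> J}"
      using param_domainD[OF p(1)] by (auto simp: z_eq add.commute)
  next
    fix x assume "x \<in> {b *\<^sub>R axis 4 1 + s *\<^sub>R r v | s v. s \<in> ?K \<and> v \<in> J}"
    then obtain u v where uv: "u \<in> I" "v \<in> J" "x = b *\<^sub>R axis 4 1 + (\<sigma> * u + a) *\<^sub>R r v" by blast
    then have "vector [u, v] \<in> D" by (simp add: param_domain_def)
    moreover from z_eq[OF this] have "x = z (vector [u, v])" using uv by (simp add: add.commute)
    ultimately show "x \<in> z ` D" by blast
  qed
  fix s v assume "s \<in> ?K" and v: "v \<in> J"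
  then have s: "s \<noteq> 0" using f f_nz by auto
  have "form (wedge (r v) (s *\<^sub>R t v)) (r v) (t v) = s"
    using frame_orthonormal[OF v] by (simp add: form_wedge)
  then have "wedge (r v) (s *\<^sub>R t v) \<noteq> 0" using s form_zero by metis
  then show "wedge (r v) (vector_derivative (\<lambda>v. b *\<^sub>R axis 4 1) (at v) + s *\<^sub>R vector_derivative r (at v)) \<noteq> 0"
    by (simp add: tangent_def)
qed

end

section \<open>Classification\<close>

text \<open>
  The derivative of \<open>f\<close> is continuous with values in \<open>{1, -1}\<close>, hence constant on the interval.
\<close>

lemma meridian_curve_constant_g:
  assumes "meridian_curve I f g" "\<forall>u\<in>I. deriv g u = 0"
  obtains \<sigma> a b where "\<sigma> = 1 \<or> \<sigma> = -1" "\<And>u. u \<in> I \<Longrightarrow> f u = \<sigma> * u + a" "\<And>u. u \<in> I \<Longrightarrow> g u = b"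
proof -
  note m = assms(1)[unfolded meridian_curve_def open_interval_def]
  have I: "open I" "convex I" "connected I" "I \<noteq> {}"
    using m by (auto simp: is_interval_convex is_interval_connected)
  have df: "(f has_vector_derivative deriv f u) (at u)" and dg: "(g has_vector_derivative deriv g u) (at u)" if "u \<in> I" for u
    using smooth_on_has_vector_derivative[OF _ that] m by (auto simp: field_derivative_eq_vector_derivative)
  have "(g has_vector_derivative 0) (at u)" if "u \<in> I" for u
    using dg[OF that] assms(2) that by simp
  then have "\<exists>b. \<forall>u\<in>I. g u = b"
    by (rule zero_derivative_imp_constant[OF I(2)])
  then obtain b where b: "\<And>u. u \<in> I \<Longrightarrow> g u = b" by blast
  have pm: "deriv f u = 1 \<or> deriv f u = -1" if "u \<in> I" for u
    using m assms(2) that by (auto simp: power2_eq_1_iff)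
  have "continuous_on I (deriv f)"
    using smooth_on_continuous_on[OF smooth_on_vector_derivative[of f I]] m I(1)
    by (simp add: field_derivative_eq_vector_derivative[abs_def])
  moreover have "finite (deriv f ` I)"
    by (rule finite_subset[of _ "{1, -1}"]) (use pm in auto)
  ultimately have "deriv f constant_on I"
    by (rule continuous_finite_range_constant[OF I(3)])
  then obtain \<sigma> where \<sigma>: "\<And>u. u \<in> I \<Longrightarrow> deriv f u = \<sigma>"
    unfolding constant_on_def by blast
  have "((\<lambda>u. f u - \<sigma> * u) has_vector_derivative 0) (at u)" if u: "u \<in> I" for u
  proof -
    have "((\<lambda>u. f u - \<sigma> * u) has_vector_derivative \<sigma> - \<sigma> * 1) (at u)"
      using df[OF u] \<sigma>[OF u] by (intro derivative_intros) auto
    then show ?thesis by simp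
  qed
  then have "\<exists>a. \<forall>u\<in>I. f u - \<sigma> * u = a"
    by (rule zero_derivative_imp_constant[OF I(2)])
  then obtain a where "\<And>u. u \<in> I \<Longrightarrow> f u - \<sigma> * u = a" by blast
  then have "f u = \<sigma> * u + a" if "u \<in> I" for u using that by (auto simp: algebra_simps)
  moreover have "\<sigma> = 1 \<or> \<sigma> = -1" using I(4) \<sigma> pm by force
  ultimately show thesis using b that by blast
qed

theorem theorem3p3:
  fixes I J :: "real set" and f g :: "real \<Rightarrow> real" and r n :: "real \<Rightarrow> real ^ 4"
    and z :: "real ^ 2 \<Rightarrow> real ^ 4" and D :: "(real ^ 2) set"
    and \<epsilon> :: "2 \<Rightarrow> real ^ 2 \<Rightarrow> real ^ 2"
  assumes "spherical_curve J r n"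
    and "meridian_curve I f g"
    and "\<forall>u\<in>I. deriv g u = 0"
    and "D = param_domain I J"
    and "z = meridian_surface f g r"
    and "\<epsilon> = meridian_frame f"
  shows "((pointwise_1type_second_kind D z \<epsilon> \<and> \<not> lies_in_dim 2 (z ` D)) \<longleftrightarrow>
           ((\<exists>S. circle S \<and> r ` J \<subseteq> S) \<and>
            (\<exists>k. k \<noteq> 0 \<and> (\<forall>v\<in>J. spherical_curvature r n v = k)) \<and>
            (\<exists>a b. ((\<forall>u\<in>I. f u = u + a) \<or> (\<forall>u\<in>I. f u = - u + a)) \<and> (\<forall>u\<in>I. g u = b)))) \<and>
         (pointwise_1type_second_kind D z \<epsilon> \<longrightarrow>
           developable_ruled D z \<and> lies_in_dim 3 (z ` D))"
proof -
  obtain \<sigma> a b where \<sigma>: "\<sigma> = 1 \<or> \<sigma> = -1" and f: "\<And>u. u \<in> I \<Longrightarrow> f u = \<sigma> * u + a" and g: "\<And>u. u \<in> I \<Longrightarrow> g u = b"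
    using meridian_curve_constant_g[OF assms(2,3)] by metis
  interpret S: flat_meridian_surface J r n I f g \<sigma> a b
    by unfold_locales (use assms(1,2) \<sigma> f g in \<open>auto simp: meridian_curve_def\<close>)
  have line: "\<exists>a b. ((\<forall>u\<in>I. f u = u + a) \<or> (\<forall>u\<in>I. f u = - u + a)) \<and> (\<forall>u\<in>I. g u = b)"
    using \<sigma> f g by fastforce
  have kind: "pointwise_1type_second_kind D z \<epsilon> \<longleftrightarrow> (\<exists>k. \<forall>v\<in>J. spherical_curvature r n v = k)"
    unfolding assms(4-6) using S.curvature_constant_if_second_kind S.second_kind_if_curvature_constant
    unfolding pointwise_1type_second_kind_def[of "param_domain I J"] by metis
  have plane: "lies_in_dim 2 (z ` D) \<longleftrightarrow> (\<forall>v\<in>J. spherical_curvature r n v = 0)"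
    unfolding assms(4-6) using S.lies_in_plane_if_curvature_zero S.curvature_zero_if_lies_in_plane by blast
  have nonzero: "(\<exists>k. \<forall>v\<in>J. spherical_curvature r n v = k) \<and> \<not> (\<forall>v\<in>J. spherical_curvature r n v = 0)
      \<longleftrightarrow> (\<exists>k. k \<noteq> 0 \<and> (\<forall>v\<in>J. spherical_curvature r n v = k))"
    using S.J_nonempty by auto
  have circ: "\<exists>S. circle S \<and> r ` J \<subseteq> S" if "\<exists>k. k \<noteq> 0 \<and> (\<forall>v\<in>J. spherical_curvature r n v = k)"
    using S.const_curvature_circle that by blast
  have dev: "developable_ruled D z" "lies_in_dim 3 (z ` D)"
    unfolding assms(4-6) developable_ruled_def using S.ruled_surface_z S.gauss_curvature_z S.lies_in_hyperplane by auto
  show ?thesis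
    unfolding kind plane nonzero using circ line dev by (intro conjI iffI impI) simp_all
qed

end
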